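(* The relation algebra $56_{65}$ does not have a fully universal representation.
   Context: A relation algebra is an algebra $\mathbf{A}=(A;\cup,\bar{\ },0,1,\mathrm{Id},\breve{\ },\circ)$ such that, with $x\cap y:=\overline{(\bar x\cup\bar y)}$, the structure $(A;\cup,\cap,\bar{\ },0,1)$ is a Boolean algebra, $\circ$ is associative, and for all $a,b,c\in A$: $(a\cup b)\circ c=(a\circ c)\cup(b\circ c)$; $a\circ\mathrm{Id}=a$; $\breve{\breve a}=a$; $(a\cup b)\breve{\ }=\breve a\cup\breve b$; $(a\circ b)\breve{\ }=\breve b\circ\breve a$; $\bar b\cup(\breve a\circ\overline{(a\circ b)})=\bar b$. Write $a\le b$ if $a\cap b=a$. An atom is a minimal element of $A\setminus\{0\}$ with respect to $\le$. In a finite relation algebra, $\circ$ and $\breve{\ }$ are determined by their values on atoms. $56_{65}$ is the finite relation algebra with exactly four atoms $\mathrm{Id},a,b,c$, all satisfying $\breve x=x$, where $\mathrm{Id}\circ x=x\circ\mathrm{Id}=x$, where for $x,y\in\{a,b,c\}$ we have $\mathrm{Id}\le x\circ y$ iff $x=y$, and where for $x,y,z\in\{a,b,c\}$ we have $z\le x\circ y$ iff $(x,y,z)$ is neither $(a,a,a)$, nor $(c,c,c)$, nor a permutation of $(c,b,b)$. A representation of $\mathbf{A}$ is a relational structure $\mathfrak{B}$ with domain $B$ and a binary relation $a^{\mathfrak{B}}\subseteq B^2$ for each $a\in A$ such that for all $a,b\in A$: $0^{\mathfrak{B}}=\varnothing$; $1^{\mathfrak{B}}=\bigcup_{a\in A}a^{\mathfrak{B}}$;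 $\mathrm{Id}^{\mathfrak{B}}=\{(u,u)\mid u\in B\}$; $(\bar a)^{\mathfrak{B}}=1^{\mathfrak{B}}\setminus a^{\mathfrak{B}}$; $(\breve a)^{\mathfrak{B}}=\{(u,v)\mid(v,u)\in a^{\mathfrak{B}}\}$; $(a\cup b)^{\mathfrak{B}}=a^{\mathfrak{B}}\cup b^{\mathfrak{B}}$; $(a\circ b)^{\mathfrak{B}}=a^{\mathfrak{B}}\circ b^{\mathfrak{B}}$ (the usual composition of binary relations). An $\mathbf{A}$-network $(V,f)$ is a finite set $V$ together with a function $f\colon V^2\to A$. It is atomic if every $f(x,y)$ is an atom, and consistent if $f(x,x)\le\mathrm{Id}$ and $f(x,y)\le f(x,z)\circ f(z,y)$ for all $x,y,z\in V$. It is satisfiable in $\mathfrak{B}$ if there is $s\colon V\to B$ with $(s(x),s(y))\in f(x,y)^{\mathfrak{B}}$ for all $x,y\in V$. A representation is fully universal if every consistent atomic $\mathbf{A}$-network is satisfiable in it. *)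

theory Defs
  imports Main
begin

section \<open>Relation algebras\<close>

text \<open>The universe of the algebra is the whole type \<^typ>\<open>'a\<close>.\<close>

record 'a relalg =
  join :: "'a \<Rightarrow> 'a \<Rightarrow> 'a"
  compl :: "'a \<Rightarrow> 'a"
  zero :: 'a
  one :: 'a
  ident :: 'a
  conv :: "'a \<Rightarrow> 'a"
  compo :: "'a \<Rightarrow> 'a \<Rightarrow> 'a"

definition meet :: "'a relalg \<Rightarrow> 'a \<Rightarrow> 'a \<Rightarrow> 'a" where
  "meet A x y = compl A (join A (compl A x) (compl A y))"

locale relation_algebra =
  fixes A :: "'a relalg"
  assumes boolean:
      "abstract_boolean_algebra (meet A) (join A) (compl A) (zero A) (one A)"
    and compo_assoc: "compo A (compo A x y) z = compo A x (compo A y z)"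
    and compo_join: "compo A (join A x y) z = join A (compo A x z) (compo A y z)"
    and compo_ident: "compo A x (ident A) = x"
    and conv_conv: "conv A (conv A x) = x"
    and conv_join: "conv A (join A x y) = join A (conv A x) (conv A y)"
    and conv_compo: "conv A (compo A x y) = compo A (conv A y) (conv A x)"
    and residuation:
      "join A (compl A y) (compo A (conv A x) (compl A (compo A x y))) = compl A y"

definition le :: "'a relalg \<Rightarrow> 'a \<Rightarrow> 'a \<Rightarrow> bool" where
  "le A x y \<longleftrightarrow> meet A x y = x"

definition atom :: "'a relalg \<Rightarrow> 'a \<Rightarrow> bool" where
  "atom A x \<longleftrightarrow> x \<noteq> zero A \<and> (\<forall>y. y \<noteq> zero A \<and> le A y x \<longrightarrow> y = x)"


section \<open>Representations and networks\<close>

definition representation ::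
    "'a relalg \<Rightarrow> 'b set \<Rightarrow> ('a \<Rightarrow> ('b \<times> 'b) set) \<Rightarrow> bool" where
  "representation A B R \<longleftrightarrow>
     (\<forall>x. R x \<subseteq> B \<times> B) \<and>
     R (zero A) = {} \<and>
     R (one A) = (\<Union>x. R x) \<and>
     R (ident A) = {(u, u) | u. u \<in> B} \<and>
     (\<forall>x. R (compl A x) = R (one A) - R x) \<and>
     (\<forall>x. R (conv A x) = {(u, v). (v, u) \<in> R x}) \<and>
     (\<forall>x y. R (join A x y) = R x \<union> R y) \<and>
     (\<forall>x y. R (compo A x y) = R x O R y)"

text \<open>In a network \<open>(V, f)\<close> only the values of \<open>f\<close> on \<open>V \<times> V\<close> matter.\<close>

definition atomic_network :: "'a relalg \<Rightarrow> 'v set \<Rightarrow> ('v \<Rightarrow> 'v \<Rightarrow> 'a) \<Rightarrow> bool" where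
  "atomic_network A V f \<longleftrightarrow> finite V \<and> (\<forall>x\<in>V. \<forall>y\<in>V. atom A (f x y))"

definition consistent :: "'a relalg \<Rightarrow> 'v set \<Rightarrow> ('v \<Rightarrow> 'v \<Rightarrow> 'a) \<Rightarrow> bool" where
  "consistent A V f \<longleftrightarrow>
     (\<forall>x\<in>V. le A (f x x) (ident A)) \<and>
     (\<forall>x\<in>V. \<forall>y\<in>V. \<forall>z\<in>V. le A (f x y) (compo A (f x z) (f z y)))"

definition satisfiable ::
    "'b set \<Rightarrow> ('a \<Rightarrow> ('b \<times> 'b) set) \<Rightarrow> 'v set \<Rightarrow> ('v \<Rightarrow> 'v \<Rightarrow> 'a) \<Rightarrow> bool" where
  "satisfiable B R V f \<longleftrightarrow>
     (\<exists>s. s ` V \<subseteq> B \<and> (\<forall>x\<in>V. \<forall>y\<in>V. (s x, s y) \<in> R (f x y)))"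

text \<open>Networks are finite, so up to renaming of vertices it suffices to quantify over
  finite sets of natural numbers (see \<open>fully_universalD\<close>).\<close>

definition fully_universal ::
    "'a relalg \<Rightarrow> 'b set \<Rightarrow> ('a \<Rightarrow> ('b \<times> 'b) set) \<Rightarrow> bool" where
  "fully_universal A B R \<longleftrightarrow>
     (\<forall>(V :: nat set) f. atomic_network A V f \<and> consistent A V f \<longrightarrow> satisfiable B R V f)"

lemma fully_universalD:
  fixes V :: "'v set"
  assumes "fully_universal A B R" "atomic_network A V f" "consistent A V f"
  shows "satisfiable B R V f"
proof -
  from assms(2) have "finite V" by (simp add: atomic_network_def)
  then obtain h :: "'v \<Rightarrow> nat" where h: "inj_on h V"
    using finite_imp_inj_to_nat_seg by blast
  define g where "g = inv_into V h"
  have g: "g (h x) = x" if "x \<in> V" for x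
    using h that by (simp add: g_def)
  have "atomic_network A (h ` V) (\<lambda>i j. f (g i) (g j))"
    using assms(2) by (simp add: atomic_network_def g)
  moreover have "consistent A (h ` V) (\<lambda>i j. f (g i) (g j))"
    using assms(3) by (simp add: consistent_def g)
  ultimately have "satisfiable B R (h ` V) (\<lambda>i j. f (g i) (g j))"
    using assms(1) by (simp add: fully_universal_def)
  then obtain s where "s ` h ` V \<subseteq> B" "\<forall>x\<in>V. \<forall>y\<in>V. (s (h x), s (h y)) \<in> R (f x y)"
    by (auto simp: satisfiable_def g)
  then show ?thesis
    unfolding satisfiable_def by (intro exI[of _ "s \<circ> h"]) auto
qed


section \<open>The relation algebra $56_{65}$\<close>

datatype atoms = At_Id | At_a | At_b | At_c

text \<open>The atoms below the composition of two atoms.\<close>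

definition atom_comp :: "atoms \<Rightarrow> atoms \<Rightarrow> atoms set" where
  "atom_comp x y =
     (if x = At_Id then {y}
      else if y = At_Id then {x}
      else {z. if z = At_Id then x = y
               else (x, y, z) \<notin> {(At_a, At_a, At_a), (At_c, At_c, At_c),
                      (At_c, At_b, At_b), (At_b, At_c, At_b), (At_b, At_b, At_c)}})"

text \<open>A finite Boolean algebra is the algebra of sets of its atoms, and composition
  distributes over joins.\<close>

definition ra56_65 :: "atoms set relalg" where
  "ra56_65 =
     \<lparr>join = (\<union>), compl = uminus, zero = {}, one = UNIV, ident = {At_Id},
      conv = (\<lambda>X. X), compo = (\<lambda>X Y. \<Union>x\<in>X. \<Union>y\<in>Y. atom_comp x y)\<rparr>"

lemma UNIV_atoms: "UNIV = {At_Id, At_a, At_b, At_c}"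
  using atoms.exhaust by auto

lemma le_ra56_65: "le ra56_65 X Y \<longleftrightarrow> X \<subseteq> Y"
  by (auto simp: le_def meet_def ra56_65_def)

lemma atom_ra56_65: "atom ra56_65 X \<longleftrightarrow> X \<in> {{At_Id}, {At_a}, {At_b}, {At_c}}"
proof -
  have "atom ra56_65 X \<longleftrightarrow> X \<noteq> {} \<and> (\<forall>Y. Y \<noteq> {} \<and> Y \<subseteq> X \<longrightarrow> Y = X)"
    by (simp add: atom_def le_ra56_65) (simp add: ra56_65_def)
  also have "\<dots> \<longleftrightarrow> (\<exists>x. X = {x})"
    by blast
  also have "\<dots> \<longleftrightarrow> X \<in> {{At_Id}, {At_a}, {At_b}, {At_c}}"
    using atoms.exhaust by auto
  finally show ?thesis .
qed

lemma atom_comp_assoc: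
  "(\<Union>u\<in>atom_comp x y. atom_comp u z) = (\<Union>u\<in>atom_comp y z. atom_comp x u)"
proof -
  have "(\<exists>u. u \<in> atom_comp x y \<and> w \<in> atom_comp u z) \<longleftrightarrow>
        (\<exists>u. u \<in> atom_comp y z \<and> w \<in> atom_comp x u)" for w
  proof -
    have ex: "(\<exists>u. P u) \<longleftrightarrow> P At_Id \<or> P At_a \<or> P At_b \<or> P At_c" for P
      by (metis atoms.exhaust)
    show ?thesis
      unfolding ex
      by (cases x; cases y; cases z; cases w; simp add: atom_comp_def)
  qed
  then show ?thesis by blast
qed

lemma atom_comp_cycle: "z \<in> atom_comp x y \<longleftrightarrow> y \<in> atom_comp x z"
  by (cases x; cases y; cases z; simp add: atom_comp_def)

lemma atom_comp_Id: "atom_comp x At_Id = {x}"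
  by (simp add: atom_comp_def)

lemma atom_comp_commute: "atom_comp x y = atom_comp y x"
  by (cases x; cases y; auto simp: atom_comp_def)

lemma relation_algebra_ra56_65: "relation_algebra ra56_65"
proof (rule relation_algebra.intro)
  show "abstract_boolean_algebra (meet ra56_65) (join ra56_65) (compl ra56_65)
          (zero ra56_65) (one ra56_65)"
    by unfold_locales (auto simp: meet_def ra56_65_def)
next
  fix X Y Z :: "atoms set"
  have "compo ra56_65 (compo ra56_65 X Y) Z
      = (\<Union>x\<in>X. \<Union>y\<in>Y. \<Union>z\<in>Z. \<Union>u\<in>atom_comp x y. atom_comp u z)"
    by (simp add: ra56_65_def) blast
  also have "\<dots> = compo ra56_65 X (compo ra56_65 Y Z)"
    unfolding atom_comp_assoc by (simp add: ra56_65_def)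
  finally show "compo ra56_65 (compo ra56_65 X Y) Z = compo ra56_65 X (compo ra56_65 Y Z)" .
  show "compo ra56_65 X (ident ra56_65) = X"
    by (simp add: ra56_65_def atom_comp_Id)
  show "conv ra56_65 (compo ra56_65 X Y) = compo ra56_65 (conv ra56_65 Y) (conv ra56_65 X)"
    by (auto simp: ra56_65_def) (metis atom_comp_commute)+
  show "join ra56_65 (compl ra56_65 Y)
      (compo ra56_65 (conv ra56_65 X) (compl ra56_65 (compo ra56_65 X Y))) = compl ra56_65 Y"
    by (auto simp: ra56_65_def) (metis atom_comp_cycle)
qed (auto simp: ra56_65_def)

end

theory Submission
  imports Defs
begin

text \<open>Consider the network on four points whose perfect matchings \<open>{01, 23}\<close>, \<open>{02, 13}\<close>,
  \<open>{03, 12}\<close> are labelled \<open>a\<close>, \<open>b\<close>, \<open>c\<close>. All its triangles are labelled \<open>abc\<close>, so it is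
  consistent. As \<open>a \<le> b \<circ> b\<close>, a representation realizing it has a point \<open>w\<close> that is
  \<open>b\<close>-related to \<open>0\<close> and \<open>1\<close>. Since \<open>(b \<circ> b) \<inter> (c \<circ> b) = a\<close>, both \<open>2w\<close> and \<open>3w\<close> are
  labelled \<open>a\<close>, which together with \<open>23\<close> gives the forbidden triangle \<open>aaa\<close>.\<close>

text \<open>The sum \<open>i + j\<close> identifies the matching of the edge \<open>ij\<close>: the
  two edges of a matching partition the four points, so their sums add up to 6.\<close>

definition matching_network :: "nat \<Rightarrow> nat \<Rightarrow> atoms set" where
  "matching_network i j =
     (if i = j then {At_Id}
      else if i + j \<in> {1, 5} then {At_a}
      else if i + j \<in> {2, 4} then {At_b}
      else {At_c})"

lemma atomic_matching_network: "atomic_network ra56_65 {0, 1, 2, 3} matching_network"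
  by (simp add: atomic_network_def atom_ra56_65 matching_network_def)

text \<open>Two edges of one matching are disjoint, so a triangle has one edge of each label.
  Triples with a repeated point only need the identity law and \<open>Id\<close> below x \<circ>
  x.\<close>

lemma consistent_matching_network: "consistent ra56_65 {0, 1, 2, 3} matching_network"
  unfolding consistent_def le_ra56_65
  by (simp add: ra56_65_def matching_network_def atom_comp_def)

context
  fixes B :: "'b set" and R :: "atoms set \<Rightarrow> ('b \<times> 'b) set"
  assumes rep: "representation ra56_65 B R"
begin

lemma representation_Un: "R (X \<union> Y) = R X \<union> R Y"
  using rep by (simp add: representation_def ra56_65_def)

lemma representation_Compl: "R (- X) = R UNIV - R X"
  using rep by (simp add: representation_def ra56_65_def)

lemma representation_empty: "R {} = {}"
  using rep by (simp add: representation_def ra56_65_def)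

lemma representation_converse: "(u, v) \<in> R X \<Longrightarrow> (v, u) \<in> R X"
  using rep by (auto simp: representation_def ra56_65_def)

lemma representation_compo: "R (compo ra56_65 X Y) = R X O R Y"
  using rep by (simp add: representation_def)

lemma representation_mono: "X \<subseteq> Y \<Longrightarrow> R X \<subseteq> R Y"
  by (metis Un_upper1 representation_Un sup.absorb2)

lemma representation_Int: "R (X \<inter> Y) = R X \<inter> R Y"
proof -
  have "R (X \<inter> Y) = R (- (- X \<union> - Y))"
    by simp
  also have "\<dots> = R UNIV - ((R UNIV - R X) \<union> (R UNIV - R Y))"
    by (simp only: representation_Compl representation_Un)
  also have "\<dots> = R X \<inter> R Y"
    \<comment> \<open>Complements are relative to \<open>R UNIV\<close>, so De Morgan needs
      \<open>R X\<close> and \<open>R Y\<close> to lie inside it.\<close>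
    using representation_mono[of X UNIV] representation_mono[of Y UNIV] by auto
  finally show ?thesis .
qed

lemma representation_IntI: "p \<in> R X \<Longrightarrow> p \<in> R Y \<Longrightarrow> X \<inter> Y = Z \<Longrightarrow> p \<in> R Z"
  using representation_Int by auto

lemma representation_trans:
  assumes "(u, v) \<in> R {x}" "(v, w) \<in> R {y}"
  shows "(u, w) \<in> R (atom_comp x y)"
proof -
  have "compo ra56_65 {x} {y} = atom_comp x y"
    by (simp add: ra56_65_def)
  then show ?thesis
    using assms representation_compo[of "{x}" "{y}"] by auto
qed

lemma matching_network_unsatisfiable:
  "\<not> satisfiable B R {0, 1, 2, 3} matching_network"
proof
  assume "satisfiable B R {0, 1, 2, 3} matching_network"
  then obtain s where sat:
      "\<forall>i\<in>{0, 1, 2, 3}. \<forall>j\<in>{0, 1, 2, 3}. (s i, s j) \<in> R (matching_network i j)"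
    unfolding satisfiable_def by (elim exE conjE)
  have s: "(s i, s j) \<in> R (matching_network i j)"
    if "i \<in> {0, 1, 2, 3}" "j \<in> {0, 1, 2, 3}" for i j
    by (rule bspec[OF bspec[OF sat that(1)] that(2)])
  have s01: "(s 0, s 1) \<in> R {At_a}"
    using s[of 0 1] by (simp add: matching_network_def)
  have "{At_a} \<subseteq> compo ra56_65 {At_b} {At_b}"
    by (simp add: ra56_65_def atom_comp_def)
  from representation_mono[OF this] s01 have "(s 0, s 1) \<in> R {At_b} O R {At_b}"
    unfolding representation_compo by (rule subsetD)
  then obtain w where w0: "(s 0, w) \<in> R {At_b}" and w1: "(s 1, w) \<in> R {At_b}"
    by (elim relcompE Pair_inject) (simp add: representation_converse)
  \<comment> \<open>Here b \<circ> b consists of \<open>Id\<close>, a, b and c \<circ> b of a,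
    c.\<close>
  have bc: "atom_comp At_b At_b \<inter> atom_comp At_c At_b = {At_a}"
    by (rule set_eqI, rename_tac z, case_tac z) (simp_all add: atom_comp_def)
  have "(s 2, w) \<in> R (atom_comp At_b At_b)" "(s 2, w) \<in> R (atom_comp At_c At_b)"
    using representation_trans[OF _ w0, of "s 2"] s[of 2 0]
      representation_trans[OF _ w1, of "s 2"] s[of 2 1]
    by (simp_all add: matching_network_def)
  then have "(s 2, w) \<in> R {At_a}"
    using bc by (rule representation_IntI)
  \<comment> \<open>The points 0 and 1 swap roles: now the b-edge is 31 and the c-edge is
    30.\<close>
  moreover have "(s 3, w) \<in> R (atom_comp At_b At_b)" "(s 3, w) \<in> R (atom_comp At_c At_b)"
    using representation_trans[OF _ w1, of "s 3"] s[of 3 1]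
      representation_trans[OF _ w0, of "s 3"] s[of 3 0]
    by (simp_all add: matching_network_def)
  then have "(s 3, w) \<in> R {At_a}"
    using bc by (rule representation_IntI)
  then have "(w, s 3) \<in> R {At_a}"
    by (rule representation_converse)
  ultimately have "(s 2, s 3) \<in> R (atom_comp At_a At_a)"
    by (rule representation_trans)
  moreover have "(s 2, s 3) \<in> R {At_a}"
    using s[of 2 3] by (simp add: matching_network_def)
  moreover have "atom_comp At_a At_a \<inter> {At_a} = {}"
    by (simp add: atom_comp_def)
  \<comment> \<open>The triangle aaa is forbidden, so the two label sets of this pair are
    disjoint.\<close>
  ultimately have "(s 2, s 3) \<in> R {}"
    by (rule representation_IntI)
  then show False
    by (simp add: representation_empty)
qed

end

theorem proposition4p27:
  "\<not> (\<exists>(B :: 'b set) (R :: atoms set \<Rightarrow> ('b \<times> 'b) set).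
        representation ra56_65 B R \<and> fully_universal ra56_65 B R)"
  using fully_universalD[OF _ atomic_matching_network consistent_matching_network]
    matching_network_unsatisfiable by blast

end
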